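(* Let $a$ and $b$ be co-prime integers with $1<a<b$. Then the set $$\mathcal{F}_{(a,b)}=\left\{\phi_{(a,b)}(p)=\frac{a^{p+d_{(a,b)}(p)}}{b^p} : p\in\mathbb{N}\right\},$$ where $d_{(a,b)}(p)$ is the smallest integer such that $1\leq\frac{a^{p+d_{(a,b)}(p)}}{b^p}$, is countable, meaning that there exists a bijection between $\mathbb{N}$ and $\mathcal{F}_{(a,b)}$.
   Context: $\mathbb{N}=\{0,1,2,\dots\}$. For $p\in\mathbb{N}$, let $q=\lceil p\log b/\log a\rceil$ be the smallest integer $q\ge 0$ with $1\le a^q/b^p$. Then $q\ge p$, and $d_{(a,b)}(p)=q-p$. In the paper "countable" means that there exists at least one bijection with $\mathbb{N}$. *)

theory Defs
  imports Complex_Main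
begin

(* The minimum is over all of int, so the exponent p + d may be negative in the
   range of the LEAST operator; as int is not well-ordered, existence of the minimum
   is not automatic. It is established by d_exp_least below. *)
definition d_exp :: "int \<Rightarrow> int \<Rightarrow> nat \<Rightarrow> int" where
  "d_exp a b p =
     (LEAST d :: int. 1 \<le> real_of_int a powi (int p + d) / real_of_int b ^ p)"

definition phi :: "int \<Rightarrow> int \<Rightarrow> nat \<Rightarrow> real" where
  "phi a b p = real_of_int a powi (int p + d_exp a b p) / real_of_int b ^ p"

definition F_set :: "int \<Rightarrow> int \<Rightarrow> real set" where
  "F_set a b = {phi a b p | p :: nat. True}"

lemma one_le_powi_div_iff:
  fixes a b d :: int and p :: nat
  assumes "1 < a" "a < b"
  shows "1 \<le> real_of_int a powi (int p + d) / real_of_int b ^ p \<longleftrightarrow>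
         \<lceil>real p * ln (real_of_int b) / ln (real_of_int a)\<rceil> - int p \<le> d"
proof -
  have a: "real_of_int a > 1" and b: "real_of_int b > 1"
    using assms by simp_all
  have la: "ln (real_of_int a) > 0"
    using a by simp
  have "1 \<le> real_of_int a powi (int p + d) / real_of_int b ^ p \<longleftrightarrow>
        real_of_int b ^ p \<le> real_of_int a powi (int p + d)"
    using b by (simp add: field_simps)
  also have "\<dots> \<longleftrightarrow> ln (real_of_int b ^ p) \<le> ln (real_of_int a powi (int p + d))"
    using a b by simp
  also have "ln (real_of_int b ^ p) = real p * ln (real_of_int b)"
    using b by (simp add: ln_realpow)
  also have "ln (real_of_int a powi (int p + d)) =
             real_of_int (int p + d) * ln (real_of_int a)"
    using a by (simp add: powr_real_of_int'[symmetric])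
  also have "real p * ln (real_of_int b) \<le> real_of_int (int p + d) * ln (real_of_int a) \<longleftrightarrow>
             real p * ln (real_of_int b) / ln (real_of_int a) \<le> real_of_int (int p + d)"
    using la by (simp add: pos_divide_le_eq)
  also have "\<dots> \<longleftrightarrow>
             \<lceil>real p * ln (real_of_int b) / ln (real_of_int a)\<rceil> \<le> int p + d"
    by (rule ceiling_le_iff[symmetric])
  finally show ?thesis by linarith
qed

lemma d_exp_eq:
  assumes "1 < a" "a < b"
  shows "d_exp a b p = \<lceil>real p * ln (real_of_int b) / ln (real_of_int a)\<rceil> - int p"
  unfolding d_exp_def one_le_powi_div_iff[OF assms] by (rule Least_equality) auto

lemma d_exp_least:
  assumes "1 < a" "a < b"
  shows "1 \<le> real_of_int a powi (int p + d) / real_of_int b ^ p \<longleftrightarrow> d_exp a b p \<le> d"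
  using assms by (simp only: one_le_powi_div_iff d_exp_eq)

lemma d_exp_nonneg:
  assumes "1 < a" "a < b"
  shows "0 \<le> d_exp a b p"
proof -
  have "real p \<le> real p * ln (real_of_int b) / ln (real_of_int a)"
    using assms by (simp add: pos_le_divide_eq mult_left_mono)
  then show ?thesis
    unfolding d_exp_eq[OF assms] by linarith
qed

end

(* The map p \<mapsto> phi(p) is itself the bijection: cross-multiplying phi(p) = phi(q) gives
   a^m b^q = a^n b^p with m, n \<ge> 0, and since a and b are coprime, b^p and b^q divide
   each other, so p = q. *)
theory Submission
  imports Defs
begin

text \<open>Coprimality cancels \<open>a ^ n\<close> from the divisibility; what remains compares
  two powers of \<open>b\<close>, and \<open>1 < b\<close> turns this into a comparison of
  exponents.\<close>

lemma coprime_power_mult_dvd_imp_le: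
  fixes a b :: int
  assumes "coprime a b" and "1 < b" and "b ^ q dvd a ^ n * b ^ p"
  shows "q \<le> p"
proof -
  have "coprime (b ^ q) (a ^ n)"
    using assms(1) by (simp add: coprime_commute)
  then have "b ^ q dvd b ^ p"
    using assms(3) by (simp add: coprime_dvd_mult_right_iff)
  then have "b ^ q \<le> b ^ p"
    using assms(2) by (simp add: zdvd_imp_le)
  then show ?thesis
    using assms(2) by simp
qed

text \<open>Since \<open>d_exp\<close> is nonnegative, \<open>nat\<close> truncates nothing. Natural
  exponents keep the powers of \<open>a\<close> integral.\<close>

lemma phi_eq_power:
  assumes "1 < a" "a < b"
  shows "phi a b p = real_of_int a ^ nat (int p + d_exp a b p) / real_of_int b ^ p"
  using d_exp_nonneg[OF assms, of p] by (simp add: phi_def power_int_def)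

lemma inj_phi:
  fixes a b :: int
  assumes "coprime a b" and "1 < a" and "a < b"
  shows "inj (phi a b)"
proof (rule injI)
  fix p q
  assume eq: "phi a b p = phi a b q"
  define m n where "m = nat (int p + d_exp a b p)" and "n = nat (int q + d_exp a b q)"
  have "real_of_int a ^ m * real_of_int b ^ q = real_of_int a ^ n * real_of_int b ^ p"
    using eq assms unfolding phi_eq_power[OF assms(2,3)] m_def n_def
    by (simp add: frac_eq_eq)
  \<comment> \<open>Injectivity of the cast moves the equation to the integers, where divisibility
    carries information.\<close>
  then have *: "a ^ m * b ^ q = a ^ n * b ^ p"
    by (simp flip: of_int_power of_int_mult)
  have b: "1 < b"
    using assms by simp
  have "b ^ q dvd a ^ n * b ^ p" "b ^ p dvd a ^ m * b ^ q"
    using * by (metis dvd_triv_right)+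
  then show "p = q"
    using coprime_power_mult_dvd_imp_le[OF assms(1) b] by (meson le_antisym)
qed

theorem theorem4p1:
  fixes a b :: int
  assumes "coprime a b" and "1 < a" and "a < b"
  shows "\<exists>f :: nat \<Rightarrow> real. bij_betw f (UNIV :: nat set) (F_set a b)"
proof -
  have "range (phi a b) = F_set a b"
    by (auto simp: F_set_def)
  then show ?thesis
    using inj_phi[OF assms] by (auto simp: bij_betw_def)
qed

end
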